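(* Let $X$ be a real vector space, let $\Omega\subset X$ be a convex set with $\mathrm{core}(\Omega)\neq\emptyset$, and let $x_0\in X$. Then the following assertions are equivalent: (a) $\Omega$ and $\{x_0\}$ are separated. (b) $\Omega$ and $\{x_0\}$ are properly separated. (c) $x_0\notin\mathrm{core}(\Omega)$.
   Context: All vector spaces are real and carry no topology. For a nonempty set $\Omega\subset X$, the algebraic core is $\mathrm{core}(\Omega):=\{x\in\Omega\mid \forall v\in X\ \exists\delta>0\ \forall t\in\mathbb{R}\text{ with }|t|<\delta:\ x+tv\in\Omega\}$. Two nonempty sets $\Omega_1,\Omega_2\subset X$ are separated (by a hyperplane) if there is a nonzero linear function $f\colon X\to\mathbb{R}$ with $\sup\{f(x)\mid x\in\Omega_1\}\le\inf\{f(x)\mid x\in\Omega_2\}$. They are properly separated if, in addition, the same $f$ satisfies $\inf\{f(x)\mid x\in\Omega_1\}<\sup\{f(x)\mid x\in\Omega_2\}$, i.e., there are $x_1\in\Omega_1$, $x_2\in\Omega_2$ with $f(x_1)<f(x_2)$. *)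

theory Defs
  imports "HOL-Analysis.Convex" "HOL-Library.Extended_Real"
begin

definition alg_core :: "'a::real_vector set \<Rightarrow> 'a set" where
  "alg_core \<Omega> =
    {x \<in> \<Omega>. \<forall>v. \<exists>\<delta>>0. \<forall>t::real. \<bar>t\<bar> < \<delta> \<longrightarrow> x + t *\<^sub>R v \<in> \<Omega>}"

(* Suprema and infima are taken in the extended reals, so that a functional unbounded on
   one of the sets gets an infinite value instead of an unspecified real number. *)

definition separates :: "('a::real_vector \<Rightarrow> real) \<Rightarrow> 'a set \<Rightarrow> 'a set \<Rightarrow> bool" where
  "separates f \<Omega>\<^sub>1 \<Omega>\<^sub>2 \<longleftrightarrow>
    linear f \<and> f \<noteq> (\<lambda>x. 0) \<and> (SUP x\<in>\<Omega>\<^sub>1. ereal (f x)) \<le> (INF x\<in>\<Omega>\<^sub>2. ereal (f x))"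

definition separated_sets :: "'a::real_vector set \<Rightarrow> 'a set \<Rightarrow> bool" where
  "separated_sets \<Omega>\<^sub>1 \<Omega>\<^sub>2 \<longleftrightarrow>
    \<Omega>\<^sub>1 \<noteq> {} \<and> \<Omega>\<^sub>2 \<noteq> {} \<and> (\<exists>f. separates f \<Omega>\<^sub>1 \<Omega>\<^sub>2)"

definition properly_separated_sets :: "'a::real_vector set \<Rightarrow> 'a set \<Rightarrow> bool" where
  "properly_separated_sets \<Omega>\<^sub>1 \<Omega>\<^sub>2 \<longleftrightarrow>
    \<Omega>\<^sub>1 \<noteq> {} \<and> \<Omega>\<^sub>2 \<noteq> {} \<and>
    (\<exists>f. separates f \<Omega>\<^sub>1 \<Omega>\<^sub>2 \<and> (INF x\<in>\<Omega>\<^sub>1. ereal (f x)) < (SUP x\<in>\<Omega>\<^sub>2. ereal (f x)))"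

end

(* Put u = a - x\<^sub>0 with a in the core of \<Omega>. If x\<^sub>0 is not in the core, the convex cone generated by
   \<Omega> - x\<^sub>0 omits -u. By Zorn's lemma it lies in a convex cone C maximal among those omitting -u;
   maximality makes C total, that is, v \<in> C or -v \<in> C for every v. So C orders the space totally,
   with u a positive order unit, and f v = sup {t. v - t u \<in> C} is a linear functional that is
   nonnegative on C and has f u = 1. Then -f separates \<Omega> from x\<^sub>0, properly because of a. *)
theory Submission imports Defs begin

text \<open>Unions of chains preserve the three conditions, so Zorn gives a maximal
  \<open>C\<close>. If it missed both \<open>v\<close> and \<open>- v\<close>, adjoining either one
  would produce \<open>p\<close>; a positive combination of the two resulting expressions for
  \<open>p\<close> cancels \<open>v\<close> and forces \<open>p\<close> into
  \<open>C\<close>.\<close>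

lemma maximal_convex_cone_omitting:
  fixes K :: "'a::real_vector set"
  assumes K: "convex_cone K" and "p \<notin> K"
  obtains C where "convex_cone C" "K \<subseteq> C" "p \<notin> C" "\<And>v. v \<in> C \<or> - v \<in> C"
proof -
  define \<A> where "\<A> = {C. convex_cone C \<and> K \<subseteq> C \<and> p \<notin> C}"
  have "\<exists>M\<in>\<A>. \<forall>X\<in>\<A>. M \<subseteq> X \<longrightarrow> X = M"
  proof (rule subset_Zorn_nonempty)
    show "\<A> \<noteq> {}"
      using assms by (auto simp: \<A>_def)
    fix \<C> assume ne: "\<C> \<noteq> {}" and ch: "subset.chain \<A> \<C>"
    have sub: "\<C> \<subseteq> \<A>" and lin: "\<And>X Y. X \<in> \<C> \<Longrightarrow> Y \<in> \<C> \<Longrightarrow> X \<subseteq> Y \<or> Y \<subseteq> X"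
      using ch unfolding subset_chain_def by blast+
    have cc: "convex_cone X" if "X \<in> \<C>" for X
      using that sub by (auto simp: \<A>_def)
    have "x + y \<in> \<Union>\<C>" if "x \<in> \<Union>\<C>" "y \<in> \<Union>\<C>" for x y
    proof -
      obtain X Y where "X \<in> \<C>" "Y \<in> \<C>" "x \<in> X" "y \<in> Y"
        using \<open>x \<in> \<Union>\<C>\<close> \<open>y \<in> \<Union>\<C>\<close> by blast
      then obtain Z where "Z \<in> \<C>" "x \<in> Z" "y \<in> Z"
        using lin[of X Y] by blast
      then show ?thesis
        using convex_cone_add[OF cc] by blast
    qed
    moreover have "c *\<^sub>R x \<in> \<Union>\<C>" if "x \<in> \<Union>\<C>" "c \<ge> 0" for x c
      using that convex_cone_scaleR[OF cc] by blast
    moreover have "0 \<in> \<Union>\<C>"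
      using ne convex_cone_contains_0[OF cc] by blast
    ultimately have "convex_cone (\<Union>\<C>)"
      unfolding convex_cone_iff by blast
    then show "\<Union>\<C> \<in> \<A>"
      using ne sub by (auto simp: \<A>_def)
  qed
  then obtain C where "C \<in> \<A>" and max: "\<And>X. X \<in> \<A> \<Longrightarrow> C \<subseteq> X \<Longrightarrow> X = C"
    by blast
  then have C: "convex_cone C" and KC: "K \<subseteq> C" and pC: "p \<notin> C"
    by (auto simp: \<A>_def)
  \<comment> \<open>The set \<open>D\<close> below is the cone generated by \<open>C\<close> and
    \<open>v\<close>. It is strictly larger than \<open>C\<close>, so maximality forces
    \<open>p \<in> D\<close>; the coefficient of \<open>v\<close> is not 0 because
    \<open>p \<notin> C\<close>.\<close>
  have decomp: "\<exists>c\<in>C. \<exists>s>0. p = c + s *\<^sub>R v" if "v \<notin> C" for v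
  proof -
    define D where "D = {c + s *\<^sub>R v | c s. c \<in> C \<and> s \<ge> 0}"
    have DI: "c + s *\<^sub>R v \<in> D" if "c \<in> C" "s \<ge> 0" for c s
      using that by (auto simp: D_def)
    have CD: "C \<subseteq> D"
      using DI[of _ 0] by auto
    have "v \<in> D"
      using DI[of 0 1] C by (simp add: convex_cone_contains_0)
    have "convex_cone D"
      unfolding convex_cone_iff
    proof (intro conjI ballI allI impI)
      show "0 \<in> D"
        using CD C convex_cone_contains_0 by blast
    next
      fix x y assume "x \<in> D" "y \<in> D"
      then obtain c s d t where *: "x = c + s *\<^sub>R v" "y = d + t *\<^sub>R v"
        "c \<in> C" "d \<in> C" "s \<ge> 0" "t \<ge> 0"
        by (auto simp: D_def)
      then have "x + y = (c + d) + (s + t) *\<^sub>R v"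
        by (simp add: algebra_simps)
      then show "x + y \<in> D"
        using DI[OF convex_cone_add[OF C *(3,4)], of "s + t"] *(5,6) by simp
    next
      fix x and k :: real assume "x \<in> D" "0 \<le> k"
      then obtain c s where *: "x = c + s *\<^sub>R v" "c \<in> C" "s \<ge> 0"
        by (auto simp: D_def)
      then have "k *\<^sub>R x = k *\<^sub>R c + (k * s) *\<^sub>R v"
        by (simp add: algebra_simps)
      then show "k *\<^sub>R x \<in> D"
        using DI[OF convex_cone_scaleR[OF C \<open>0 \<le> k\<close> *(2)], of "k * s"] *(3) \<open>0 \<le> k\<close> by simp
    qed
    then have "p \<in> D"
      using max[of D] CD KC \<open>v \<in> D\<close> that by (auto simp: \<A>_def)
    then obtain c s where *: "p = c + s *\<^sub>R v" "c \<in> C" "s \<ge> 0"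
      by (auto simp: D_def)
    with pC have "s \<noteq> 0"
      by auto
    with * show ?thesis
      by force
  qed
  have "v \<in> C \<or> - v \<in> C" for v
  proof (rule ccontr)
    assume "\<not> ?thesis"
    then obtain c s d t where cd: "c \<in> C" "d \<in> C" and pos: "s > 0" "t > 0"
      and p: "p = c + s *\<^sub>R v" "p = d + t *\<^sub>R (- v)"
      using decomp[of v] decomp[of "- v"] by blast
    \<comment> \<open>Weighting the first expression by \<open>t\<close> and the second by
      \<open>s\<close> makes the multiples of \<open>v\<close> cancel.\<close>
    have "(s + t) *\<^sub>R p = t *\<^sub>R p + s *\<^sub>R p"
      by (simp add: algebra_simps)
    also have "\<dots> = t *\<^sub>R (c + s *\<^sub>R v) + s *\<^sub>R (d + t *\<^sub>R (- v))"
      using p by metis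
    also have "\<dots> = t *\<^sub>R c + s *\<^sub>R d"
      by (simp add: algebra_simps)
    finally have "(s + t) *\<^sub>R p \<in> C"
      using C cd pos by (simp add: convex_cone_add convex_cone_scaleR)
    then have "inverse (s + t) *\<^sub>R (s + t) *\<^sub>R p \<in> C"
      by (rule convex_cone_scaleR[OF C, rotated]) (use pos in simp)
    with pC pos show False
      by simp
  qed
  with that C KC pC show thesis
    by blast
qed

text \<open>Read \<open>C\<close> as the nonnegative elements of a preorder. Then \<open>T v\<close>
  is the lower half of a Dedekind cut: the reals \<open>t\<close> with \<open>t *\<^sub>R u\<close>
  below \<open>v\<close>. The cone laws alone make its supremum superadditive; totality makes it
  odd, and an odd superadditive function is additive. The supremum need not be attained.\<close>

lemma total_convex_cone_functional:
  fixes C :: "'a::real_vector set"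
  assumes C: "convex_cone C" and total: "\<And>v. v \<in> C \<or> - v \<in> C"
    and u: "- u \<notin> C" and unit: "\<And>v. \<exists>s. v + s *\<^sub>R u \<in> C"
  obtains f :: "'a \<Rightarrow> real" where "linear f" "f u = 1" "\<And>v. v \<in> C \<Longrightarrow> 0 \<le> f v"
proof -
  define T where "T v = {t. v - t *\<^sub>R u \<in> C}" for v
  define f where "f v = Sup (T v)" for v
  \<comment> \<open>A negative multiple of \<open>u\<close> in \<open>C\<close> could be rescaled to
    \<open>- u\<close>.\<close>
  have multiple: "0 \<le> t" if "t *\<^sub>R u \<in> C" for t
  proof (rule ccontr)
    assume "\<not> 0 \<le> t"
    then have "inverse (- t) *\<^sub>R t *\<^sub>R u \<in> C"
      by (intro convex_cone_scaleR[OF C _ that]) simp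
    with \<open>\<not> 0 \<le> t\<close> u show False
      by simp
  qed
  have ne: "T v \<noteq> {}" for v
  proof -
    obtain s where "v + s *\<^sub>R u \<in> C"
      using unit by blast
    then have "- s \<in> T v"
      by (simp add: T_def)
    then show ?thesis
      by blast
  qed
  \<comment> \<open>The two members of \<open>C\<close> add up to a multiple of \<open>u\<close>
    alone. Hence the negative of any element of \<open>T (- v)\<close> bounds \<open>T v\<close>
    above.\<close>
  have sum_nonpos: "s + t \<le> 0" if "s \<in> T v" "t \<in> T (- v)" for s t v
  proof -
    have "(v - s *\<^sub>R u) + (- v - t *\<^sub>R u) \<in> C"
      using that C by (intro convex_cone_add) (auto simp: T_def)
    also have "(v - s *\<^sub>R u) + (- v - t *\<^sub>R u) = (- (s + t)) *\<^sub>R u"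
      by (simp add: algebra_simps)
    finally show ?thesis
      using multiple by fastforce
  qed
  have bdd: "bdd_above (T v)" for v
  proof -
    obtain t where "t \<in> T (- v)"
      using ne by blast
    then show ?thesis
      using sum_nonpos by (intro bdd_aboveI[of _ "- t"]) fastforce
  qed
  have upper: "t \<le> f v" if "t \<in> T v" for t v
    unfolding f_def using that bdd by (rule cSup_upper)
  have least: "f v \<le> z" if "\<And>t. t \<in> T v \<Longrightarrow> t \<le> z" for v z
    unfolding f_def using ne that by (rule cSup_least)
  have superadd: "f v + f w \<le> f (v + w)" for v w
  proof -
    have "s + t \<le> f (v + w)" if "s \<in> T v" "t \<in> T w" for s t
    proof (rule upper)
      have "(v - s *\<^sub>R u) + (w - t *\<^sub>R u) \<in> C"
        using that C by (intro convex_cone_add) (auto simp: T_def)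
      then show "s + t \<in> T (v + w)"
        by (simp add: T_def algebra_simps)
    qed
    then have "s \<le> f (v + w) - t" if "s \<in> T v" "t \<in> T w" for s t
      using that by fastforce
    then have "f v \<le> f (v + w) - t" if "t \<in> T w" for t
      using that least by blast
    then have "f w \<le> f (v + w) - f v"
      by (intro least) fastforce
    then show ?thesis
      by simp
  qed
  have neg: "f (- v) = - f v" for v
  proof (rule antisym)
    have "s \<le> - f (- v)" if "s \<in> T v" for s
    proof -
      have "f (- v) \<le> - s"
        using sum_nonpos[OF that] by (intro least) fastforce
      then show ?thesis
        by simp
    qed
    then show "f (- v) \<le> - f v"
      using least by fastforce
    \<comment> \<open>This is where totality enters: a \<open>t\<close> above the supremum is
      outside \<open>T v\<close>, so the opposite vector lies in \<open>C\<close>. Letting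
      \<open>t\<close> decrease to \<open>f v\<close> then gives the bound.\<close>
    have "- t \<le> f (- v)" if "f v < t" for t
    proof (rule upper)
      have "v - t *\<^sub>R u \<notin> C"
        using that upper[of t v] by (auto simp: T_def)
      then have "- (v - t *\<^sub>R u) \<in> C"
        using total by blast
      then show "- t \<in> T (- v)"
        by (simp add: T_def)
    qed
    then have "- f (- v) \<le> t" if "f v < t" for t
      using that by fastforce
    then have "- f (- v) \<le> f v"
      by (rule dense_ge)
    then show "- f v \<le> f (- v)"
      by simp
  qed
  \<comment> \<open>Superadditivity at \<open>- v\<close> and \<open>- w\<close>, read through
    oddness, is the reverse inequality.\<close>
  have add: "f (v + w) = f v + f w" for v w
    using superadd[of v w] superadd[of "- v" "- w"] neg[of "v + w"] neg[of v] neg[of w] by simp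
  have scale_le: "c * f v \<le> f (c *\<^sub>R v)" if "0 < c" for c v
  proof -
    have "t \<le> f (c *\<^sub>R v) / c" if "t \<in> T v" for t
    proof -
      have "c *\<^sub>R (v - t *\<^sub>R u) \<in> C"
        using that C \<open>0 < c\<close> by (intro convex_cone_scaleR) (auto simp: T_def)
      then have "c * t \<in> T (c *\<^sub>R v)"
        by (simp add: T_def algebra_simps)
      then show ?thesis
        using upper \<open>0 < c\<close> by (simp add: pos_le_divide_eq mult.commute)
    qed
    then have "f v \<le> f (c *\<^sub>R v) / c"
      by (rule least)
    then show ?thesis
      using \<open>0 < c\<close> by (simp add: pos_le_divide_eq mult.commute)
  qed
  \<comment> \<open>Again the inequality for \<open>- v\<close> reverses the one for
    \<open>v\<close>.\<close>
  have scale_pos: "f (c *\<^sub>R v) = c * f v" if "0 < c" for c v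
    using scale_le[OF that, of v] scale_le[OF that, of "- v"] neg[of v] neg[of "c *\<^sub>R v"] by simp
  have "f 0 = 0"
    using add[of 0 0] by simp
  have scale: "f (c *\<^sub>R v) = c * f v" for c v
  proof -
    consider "c = 0" | "0 < c" | "0 < - c"
      by linarith
    then show ?thesis
    proof cases
      case 3
      then show ?thesis
        using scale_pos[of "- c" v] neg[of "c *\<^sub>R v"] by simp
    qed (use \<open>f 0 = 0\<close> scale_pos in auto)
  qed
  have "linear f"
    by (rule linearI) (simp_all add: add scale)
  moreover have "f u = 1"
  proof (rule antisym)
    show "f u \<le> 1"
    proof (rule least)
      fix t assume "t \<in> T u"
      then have "(1 - t) *\<^sub>R u \<in> C"
        by (simp add: T_def algebra_simps)
      then show "t \<le> 1"
        using multiple by fastforce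
    qed
    show "1 \<le> f u"
      using C by (intro upper) (simp add: T_def convex_cone_contains_0)
  qed
  moreover have "0 \<le> f v" if "v \<in> C" for v
    using that by (intro upper) (simp add: T_def)
  ultimately show thesis
    using that by blast
qed

text \<open>The contraction towards \<open>y\<close> with ratio \<open>r\<close> maps \<Omega> into
  itself by convexity, so a radius \<delta> that works at \<open>a\<close> becomes
  \<open>r * \<delta>\<close> at the image of \<open>a\<close>.\<close>

lemma alg_core_convex_combination:
  fixes \<Omega> :: "'a::real_vector set"
  assumes "convex \<Omega>" "a \<in> alg_core \<Omega>" "y \<in> \<Omega>" "0 < r" "r \<le> 1"
  shows "r *\<^sub>R a + (1 - r) *\<^sub>R y \<in> alg_core \<Omega>"
proof -
  have comb: "r *\<^sub>R z + (1 - r) *\<^sub>R y \<in> \<Omega>" if "z \<in> \<Omega>" for z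
    using assms that by (intro convexD) auto
  have "\<exists>\<delta>>0. \<forall>t. \<bar>t\<bar> < \<delta> \<longrightarrow> r *\<^sub>R a + (1 - r) *\<^sub>R y + t *\<^sub>R v \<in> \<Omega>" for v
  proof -
    obtain \<delta> where \<delta>: "\<delta> > 0" "\<And>t. \<bar>t\<bar> < \<delta> \<Longrightarrow> a + t *\<^sub>R v \<in> \<Omega>"
      using assms(2) unfolding alg_core_def by blast
    have "r *\<^sub>R a + (1 - r) *\<^sub>R y + t *\<^sub>R v \<in> \<Omega>" if "\<bar>t\<bar> < r * \<delta>" for t
    proof -
      have "\<bar>t / r\<bar> < \<delta>"
        using that \<open>0 < r\<close> by (simp add: pos_divide_less_eq mult.commute)
      then have "r *\<^sub>R (a + (t / r) *\<^sub>R v) + (1 - r) *\<^sub>R y \<in> \<Omega>"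
        using \<delta> comb by blast
      then show ?thesis
        using \<open>0 < r\<close> by (simp add: algebra_simps)
    qed
    then show ?thesis
      using \<delta>(1) \<open>0 < r\<close> by (intro exI[of _ "r * \<delta>"]) simp
  qed
  moreover have "a \<in> \<Omega>"
    using assms(2) by (simp add: alg_core_def)
  ultimately show ?thesis
    using comb by (simp add: alg_core_def)
qed

text \<open>The core point \<open>a\<close> serves twice: with \<open>x\<^sub>0\<close> outside the
  core it keeps \<open>- u\<close> out of the generated cone, and it makes \<open>u\<close> an order
  unit. The strict inequality at \<open>a\<close> is what later yields proper separation.\<close>

lemma separating_functional_alg_core:
  fixes \<Omega> :: "'a::real_vector set"
  assumes \<Omega>: "convex \<Omega>" and a: "a \<in> alg_core \<Omega>" and x\<^sub>0: "x\<^sub>0 \<notin> alg_core \<Omega>"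
  obtains f :: "'a \<Rightarrow> real" where "linear f" "f a < f x\<^sub>0" "\<And>x. x \<in> \<Omega> \<Longrightarrow> f x \<le> f x\<^sub>0"
proof -
  define u where "u = a - x\<^sub>0"
  define S where "S = (\<lambda>x. x - x\<^sub>0) ` \<Omega>"
  define K where "K = convex_cone hull S"
  have "a \<in> \<Omega>"
    using a by (simp add: alg_core_def)
  then have "S \<noteq> {}"
    by (auto simp: S_def)
  moreover have "convex hull S = S"
    unfolding S_def using \<Omega> convex_translation_subtract by (metis convex_hull_eq)
  \<comment> \<open>As \<open>S\<close> is convex and nonempty, its conic hull consists just of its
    nonnegative multiples.\<close>
  ultimately have K_eq: "K = (\<Union>x\<in>S. \<Union>c\<in>{0..}. {c *\<^sub>R x})"
    by (simp add: K_def convex_cone_hull_convex_hull_nonempty)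
  have "- u \<notin> K"
  proof
    assume "- u \<in> K"
    then obtain y c where y: "y \<in> \<Omega>" and "c \<ge> 0" and eq: "- u = c *\<^sub>R (y - x\<^sub>0)"
      by (auto simp: K_eq S_def)
    \<comment> \<open>Solving \<open>eq\<close> for \<open>x\<^sub>0\<close> gives a convex
      combination of \<open>a\<close> and \<open>y\<close> in which \<open>a\<close> has this
      positive weight, so \<open>x\<^sub>0\<close> would be in the core.\<close>
    define r where "r = 1 / (1 + c)"
    have r: "0 < r" "r \<le> 1" "r * (1 + c) = 1" "1 - r = r * c"
      using \<open>c \<ge> 0\<close> by (auto simp: r_def field_simps)
    have "(1 + c) *\<^sub>R x\<^sub>0 = a + c *\<^sub>R y"
      using eq by (simp add: u_def algebra_simps)
    then have "r *\<^sub>R (1 + c) *\<^sub>R x\<^sub>0 = r *\<^sub>R (a + c *\<^sub>R y)"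
      by simp
    then have "x\<^sub>0 = r *\<^sub>R a + (1 - r) *\<^sub>R y"
      using r by (simp add: scaleR_add_right)
    then show False
      using alg_core_convex_combination[OF \<Omega> a y r(1,2)] x\<^sub>0 by simp
  qed
  moreover have "convex_cone K"
    by (simp add: K_def convex_cone_convex_cone_hull)
  ultimately obtain C where C: "convex_cone C" "K \<subseteq> C" "- u \<notin> C" "\<And>v. v \<in> C \<or> - v \<in> C"
    using maximal_convex_cone_omitting by blast
  have SC: "x - x\<^sub>0 \<in> C" if "x \<in> \<Omega>" for x
    using that C(2) hull_subset[of S convex_cone] by (auto simp: K_def S_def)
  have unit: "\<exists>s. v + s *\<^sub>R u \<in> C" for v
  proof -
    obtain \<delta> where \<delta>: "\<delta> > 0" "\<And>t. \<bar>t\<bar> < \<delta> \<Longrightarrow> a + t *\<^sub>R v \<in> \<Omega>"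
      using a unfolding alg_core_def by blast
    \<comment> \<open>A move of length \<delta>/2 from \<open>a\<close> along \<open>v\<close> stays
      in \<Omega>; rescaling it to a full \<open>v\<close> turns the offset \<open>u\<close> into
      \<open>(2 / \<delta>) *\<^sub>R u\<close>.\<close>
    have "(2 / \<delta>) *\<^sub>R (a + (\<delta> / 2) *\<^sub>R v - x\<^sub>0) \<in> C"
      using \<delta> C(1) by (intro convex_cone_scaleR SC) auto
    also have "(2 / \<delta>) *\<^sub>R (a + (\<delta> / 2) *\<^sub>R v - x\<^sub>0) = v + (2 / \<delta>) *\<^sub>R u"
      using \<delta>(1) by (simp add: u_def algebra_simps)
    finally show ?thesis
      by blast
  qed
  obtain f :: "'a \<Rightarrow> real" where f: "linear f" "f u = 1" "\<And>v. v \<in> C \<Longrightarrow> 0 \<le> f v"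
    by (rule total_convex_cone_functional[OF C(1,4,3) unit]) (erule that; simp)
  show thesis
  proof (rule that)
    \<comment> \<open>Nonnegativity on \<open>C\<close> places \<Omega> above
      \<open>x\<^sub>0\<close>, so the sign is flipped.\<close>
    show "linear (\<lambda>x. - f x)"
      using f(1) by (rule linear_compose_neg)
    show "- f a < - f x\<^sub>0"
      using f(2) linear_diff[OF f(1), of a x\<^sub>0] by (simp add: u_def)
    show "- f x \<le> - f x\<^sub>0" if "x \<in> \<Omega>" for x
      using f(3)[OF SC[OF that]] linear_diff[OF f(1), of x x\<^sub>0] by simp
  qed
qed

lemma separates_singleton_iff:
  "separates f \<Omega> {z} \<longleftrightarrow> linear f \<and> f \<noteq> (\<lambda>x. 0) \<and> (\<forall>x\<in>\<Omega>. f x \<le> f z)"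
  by (simp add: separates_def SUP_le_iff)

text \<open>A nonzero linear functional is positive in some direction, and from a core point a short
  move in that direction stays in \<Omega>.\<close>

lemma alg_core_not_maximizer:
  fixes f :: "'a::real_vector \<Rightarrow> real"
  assumes "linear f" "f \<noteq> (\<lambda>x. 0)" "z \<in> alg_core \<Omega>"
  shows "\<exists>x\<in>\<Omega>. f z < f x"
proof -
  obtain w where "f w \<noteq> 0"
    using assms(2) by blast
  then have "0 < f w \<or> 0 < f (- w)"
    using linear_neg[OF assms(1), of w] by linarith
  then obtain v where v: "0 < f v"
    by blast
  obtain \<delta> where \<delta>: "\<delta> > 0" "\<And>t. \<bar>t\<bar> < \<delta> \<Longrightarrow> z + t *\<^sub>R v \<in> \<Omega>"
    using assms(3) unfolding alg_core_def by blast
  have "z + (\<delta> / 2) *\<^sub>R v \<in> \<Omega>"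
    using \<delta> by simp
  moreover have "f z < f (z + (\<delta> / 2) *\<^sub>R v)"
    using v \<delta>(1) by (simp add: linear_add[OF assms(1)] linear_scale[OF assms(1)])
  ultimately show ?thesis
    by blast
qed

theorem theorem3p4:
  fixes \<Omega> :: "'a::real_vector set" and x\<^sub>0 :: 'a
  assumes "convex \<Omega>" and "alg_core \<Omega> \<noteq> {}"
  shows "(separated_sets \<Omega> {x\<^sub>0} \<longleftrightarrow> properly_separated_sets \<Omega> {x\<^sub>0}) \<and>
         (properly_separated_sets \<Omega> {x\<^sub>0} \<longleftrightarrow> x\<^sub>0 \<notin> alg_core \<Omega>)"
proof -
  \<comment> \<open>The equivalences are closed as a cycle: proper separation, separation,
    \<open>x\<^sub>0\<close> outside the core, and back.\<close>
  have "separated_sets \<Omega> {x\<^sub>0}" if "properly_separated_sets \<Omega> {x\<^sub>0}"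
    using that by (auto simp: properly_separated_sets_def separated_sets_def)
  moreover have "x\<^sub>0 \<notin> alg_core \<Omega>" if "separated_sets \<Omega> {x\<^sub>0}"
    using that alg_core_not_maximizer
    by (fastforce simp: separated_sets_def separates_singleton_iff)
  moreover have "properly_separated_sets \<Omega> {x\<^sub>0}" if x\<^sub>0: "x\<^sub>0 \<notin> alg_core \<Omega>"
  proof -
    obtain a where a: "a \<in> alg_core \<Omega>"
      using assms(2) by blast
    then have "a \<in> \<Omega>"
      by (simp add: alg_core_def)
    obtain f :: "'a \<Rightarrow> real" where f: "linear f" "f a < f x\<^sub>0" "\<And>x. x \<in> \<Omega> \<Longrightarrow> f x \<le> f x\<^sub>0"
      using separating_functional_alg_core[OF assms(1) a x\<^sub>0] by blast
    \<comment> \<open>The inequality \<open>f a < f x\<^sub>0\<close> shows that \<open>f\<close> is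
      nonzero here, and it gives the strict inequality for properness next.\<close>
    have "separates f \<Omega> {x\<^sub>0}"
      using f by (auto simp: separates_singleton_iff)
    moreover have "(INF x\<in>\<Omega>. ereal (f x)) < (SUP x\<in>{x\<^sub>0}. ereal (f x))"
      using f(2) \<open>a \<in> \<Omega>\<close> by (auto simp: INF_less_iff)
    ultimately show ?thesis
      using \<open>a \<in> \<Omega>\<close> by (auto simp: properly_separated_sets_def)
  qed
  ultimately show ?thesis
    by blast
qed

end
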